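(* Let $k$ be a positive integer. For any prime $p$ and any positive integer $a$, $$O_{p^a}\big(k+p^{\gamma_p(k)+1}m\big)=O_{p^a}(k),$$ where $m\in\mathbb{N}$, $m\neq 0$.
   Context: $O_N(k)$ denotes the multiplicative order of $k$ modulo $N$, i.e. the first positive integer $t$ such that $k^t\equiv 1 \bmod N$. $\nu_p(x)$ is the exponent of the highest power of the prime $p$ dividing $x$. The quantity $\gamma_p(k)$ is defined by $\gamma_p(k)=\nu_p(k^u-1)$ with $u=O_p(k)$ if $p\neq 2$ or $k-1$ is not twice an odd integer, and by $\gamma_2(k)=\nu_2(k^2-1)$ if $p=2$ and $k-1$ is twice an odd integer. Conventions: if $p$ divides no $k^u-1$ with $u\geq 1$, then $\gamma_p(k)=0$; if $k=1$, the quantity $p^{\gamma_p(k)+1}$ is taken to be $0$. *)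

theory Defs
  imports "HOL-Number_Theory.Number_Theory"
begin

(* The order of k modulo N is the library's ord N k; it is 0 exactly when k is not
   coprime to N, i.e. when no positive exponent t has k^t = 1 (mod N).
   Arguments k are positive, so subtraction on nat in k - 1 and k ^ u - 1 never truncates. *)

definition gamma :: "nat \<Rightarrow> nat \<Rightarrow> nat" where
  "gamma p k =
    (if \<not> (\<exists>u\<ge>1. p dvd k ^ u - 1) then 0
     else if p = 2 \<and> (\<exists>j. odd j \<and> k - 1 = 2 * j) then multiplicity 2 (k ^ 2 - 1)
     else multiplicity p (k ^ ord p k - 1))"

(* p to the power gamma p k + 1, with the convention that it is 0 for k = 1: there the
   exponent is infinite, whereas the library's multiplicity p 0 is 0, so that gamma p 1 = 0
   is a dummy value. *)
definition gamma_power :: "nat \<Rightarrow> nat \<Rightarrow> nat" where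
  "gamma_power p k = (if k = 1 then 0 else p ^ (gamma p k + 1))"

end

theory Submission
  imports Defs
begin

text \<open>Let \<open>k > 1\<close> be prime to \<open>p\<close>. Put \<open>q = p\<close> for odd \<open>p\<close> and \<open>q = 4\<close> for \<open>p = 2\<close>, let \<open>w\<close> be the order of \<open>k\<close> modulo \<open>q\<close>;
  then \<open>\<gamma> = \<nu>\<^sub>p (k^w - 1)\<close> in all cases, and \<open>q\<close> divides \<open>p^\<gamma>\<close>. If \<open>a \<le> \<gamma> + 1\<close>, the two bases agree
  modulo \<open>p^a\<close>. Otherwise \<open>p^a\<close> divides \<open>k^n - 1\<close> only if \<open>w\<close> divides \<open>n\<close>, and then lifting the exponent shows
  that \<open>\<nu>\<^sub>p (k^n - 1) = \<gamma> + \<nu>\<^sub>p (n div w)\<close>. Both \<open>w\<close> and \<open>\<gamma>\<close> are unchanged by a translation of \<open>k\<close>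
  by a multiple of \<open>p^(\<gamma> + 1)\<close>.\<close>

text \<open>Lifting the exponent, one factor \<open>p\<close> of \<open>n\<close> at a time: the
  geometric sum \<open>(x ^ n - 1) / (x - 1)\<close> is prime to \<open>p\<close> when
  \<open>p\<close> does not divide \<open>n\<close>, and passing from \<open>y = x ^ n'\<close> to
  \<open>y ^ p\<close> gains exactly one factor \<open>p\<close>. For \<open>p = 2\<close> the
  divisor 4 matters: \<open>x = 3\<close>, \<open>n = 2\<close> would give 3 on the left and 2 on
  the right.\<close>

lemma multiplicity_power_minus_one:
  fixes x :: int
  assumes p: "prime p" and "n > 0" and "x > 1" and "int p dvd x - 1" and "p = 2 \<Longrightarrow> 4 dvd x - 1"
  shows "multiplicity (int p) (x ^ n - 1) = multiplicity (int p) (x - 1) + multiplicity p n"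
  using assms(2)
proof (induction n rule: less_induct)
  case (less n)
  have pe: "prime_elem (int p)" and p1: "p > 1"
    using p by (simp_all add: prime_gt_1_nat del: One_nat_def)
  have split: "multiplicity (int p) (y ^ r - 1) =
      multiplicity (int p) (y - 1) + multiplicity (int p) (\<Sum>i<r. y ^ i)"
    if "y > 1" "r > 0" for y :: int and r
  proof -
    have "(\<Sum>i<r. y ^ i) > 0"
      using that by (intro sum_pos) auto
    then show ?thesis
      using that pe by (simp add: power_diff_1_eq prime_elem_multiplicity_mult_distrib)
  qed
  show ?case
  proof (cases "p dvd n")
    case False
    have "[(\<Sum>i<n. x ^ i) = (\<Sum>i<n. 1 ^ i)] (mod int p)"
      using assms(4) by (intro cong_sum cong_pow) (simp add: cong_iff_dvd_diff)
    then have "[(\<Sum>i<n. x ^ i) = int n] (mod int p)"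
      by simp
    then have "\<not> int p dvd (\<Sum>i<n. x ^ i)"
      using False cong_dvd_iff[of "\<Sum>i<n. x ^ i" "int n" "int p"] by simp
    then show ?thesis
      using False split[OF \<open>x > 1\<close> \<open>n > 0\<close>] by (simp add: not_dvd_imp_multiplicity_0)
  next
    case True
    then obtain n' where n': "n = n' * p"
      by (metis dvdE mult.commute)
    with \<open>n > 0\<close> have "n' > 0" by simp
    define y where "y = x ^ n'"
    have xy: "x - 1 dvd y - 1"
      unfolding y_def by (simp add: power_diff_1_eq)
    have "y > 1"
      using \<open>n' > 0\<close> \<open>x > 1\<close> by (simp add: y_def)
    obtain z where z: "y = 1 + int p * z"
      using dvd_trans[OF assms(4) xy] by (metis add.commute diff_add_cancel dvdE)
    \<comment> \<open>This is the binomial expansion of \<open>(1 + p * z) ^ i\<close>, cut off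
      after the linear term.\<close>
    have lin: "[y ^ i = 1 + int i * (int p * z)] (mod (int p)\<^sup>2)" for i
    proof (induction i)
      case (Suc i)
      have "[y ^ Suc i = (1 + int i * (int p * z)) * y] (mod (int p)\<^sup>2)"
        using cong_scalar_right[OF Suc] by (simp only: power_Suc2)
      also have "(1 + int i * (int p * z)) * y
          = 1 + int (Suc i) * (int p * z) + (int p)\<^sup>2 * (int i * z\<^sup>2)"
        by (simp add: z algebra_simps power2_eq_square)
      also have "[\<dots> = 1 + int (Suc i) * (int p * z)] (mod (int p)\<^sup>2)"
        by (simp add: cong_iff_dvd_diff)
      finally show ?case .
    qed simp
    have "[(\<Sum>i<p. y ^ i) = (\<Sum>i<p. 1 + int i * (int p * z))] (mod (int p)\<^sup>2)"
      by (intro cong_sum lin)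
    also have "(\<Sum>i<p. 1 + int i * (int p * z)) = int p + int p * (z * int (\<Sum>i<p. i))"
      by (simp add: sum.distrib sum_distrib_left sum_distrib_right mult_ac)
    also have "[\<dots> = int p] (mod (int p)\<^sup>2)"
    proof -
      \<comment> \<open>For odd \<open>p\<close> the factor \<open>p\<close> comes from the sum
        \<open>p * (p - 1) / 2\<close>. For \<open>p = 2\<close> that sum is 1, and \<open>z\<close>
        itself is even because 4 divides \<open>y - 1 = 2 * z\<close>.\<close>
      have "int p dvd z * int (\<Sum>i<p. i)"
      proof (cases "p = 2")
        case True
        then have "4 dvd 2 * z"
          using dvd_trans[OF assms(5)[OF True] xy] z by simp
        then show ?thesis using True by auto
      next
        case False
        then have "odd p"
          using p by (simp add: prime_odd_nat prime_ge_2_nat le_neq_implies_less)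
        have "(\<Sum>i<p. i) = p * (p - 1) div 2"
          by (simp add: lessThan_atLeast0 Sum_Ico_nat)
        also have "\<dots> = p * ((p - 1) div 2)"
          using \<open>odd p\<close> by (simp add: div_mult_swap)
        finally show ?thesis by simp
      qed
      then show ?thesis
        by (simp add: cong_iff_dvd_diff power2_eq_square)
    qed
    finally have S: "[(\<Sum>i<p. y ^ i) = int p] (mod (int p)\<^sup>2)" .
    have "multiplicity (int p) (\<Sum>i<p. y ^ i) = 1"
    proof (rule multiplicity_eqI)
      show "int p ^ 1 dvd (\<Sum>i<p. y ^ i)"
        using cong_dvd_iff[OF cong_dvd_modulus[OF S, of "int p"]] by (simp add: power2_eq_square)
      have "\<not> (int p)\<^sup>2 dvd int p"
        using p1 by (auto simp: power2_eq_square dest: zdvd_imp_le)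
      then show "\<not> int p ^ Suc 1 dvd (\<Sum>i<p. y ^ i)"
        using cong_dvd_iff[OF S] by (simp add: power2_eq_square)
    qed
    moreover have "multiplicity p n = multiplicity p n' + 1"
      using n' p p1 \<open>n' > 0\<close> by (simp add: prime_elem_multiplicity_mult_distrib)
    moreover have "multiplicity (int p) (y - 1) = multiplicity (int p) (x - 1) + multiplicity p n'"
      unfolding y_def using n' p1 \<open>n' > 0\<close> by (intro less.IH) auto
    moreover have "x ^ n = y ^ p"
      by (simp add: y_def n' power_mult)
    ultimately show ?thesis
      using split[OF \<open>y > 1\<close>, of p] p1 by simp
  qed
qed

lemma multiplicity_int_int: "multiplicity (int p) (int n) = multiplicity p n"
  unfolding multiplicity_def by (simp flip: of_nat_power)

text \<open>Each order divides the other, being itself an exponent that gives 1. This covers bases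
  not coprime to \<open>N\<close> too, where 0 is the order and the only such exponent.\<close>

lemma ord_eqI:
  fixes k l N :: nat
  assumes "\<And>d. [k ^ d = 1] (mod N) \<longleftrightarrow> [l ^ d = 1] (mod N)"
  shows "ord N k = ord N l"
proof (rule dvd_antisym)
  show "ord N k dvd ord N l"
    by (simp only: ord_divides[symmetric] assms ord)
  show "ord N l dvd ord N k"
    by (simp only: ord_divides[symmetric] assms[symmetric] ord)
qed

text \<open>Since \<open>q\<close> divides \<open>p ^ a\<close>, only multiples of
  \<open>w = ord q k\<close> can qualify, and on these the exponent is lifted from the base
  \<open>k ^ w\<close>. Taking \<open>q = 4\<close> for \<open>p = 2\<close> supplies the
  divisibility by 4 that lifting requires there.\<close>

lemma power_cong_1_iff:
  fixes k :: nat
  assumes p: "prime p" and k: "k > 1" "n > 0"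
    and q: "if p = 2 then q = 4 else q = p" "coprime q k" "q dvd p ^ a"
  shows "[k ^ n = 1] (mod p ^ a) \<longleftrightarrow> ord q k dvd n \<and>
    a \<le> multiplicity (int p) (int k ^ ord q k - 1) + multiplicity p (n div ord q k)"
proof (cases "ord q k dvd n")
  case False
  then have "\<not> [k ^ n = 1] (mod q)"
    by (simp only: ord_divides not_False_eq_True)
  with False q(3) show ?thesis
    using cong_dvd_modulus_nat by blast
next
  case True
  define w where "w = ord q k"
  have "w > 0" using q(2) by (simp add: w_def ord_eq_0)
  obtain r where r: "n = w * r" using True by (auto simp: w_def)
  with \<open>n > 0\<close> have "r > 0" by simp
  have "[k ^ w = 1] (mod q)" unfolding w_def by (rule ord)
  then have "[int k ^ w = 1] (mod int q)"
    by (metis cong_int_iff of_nat_1 of_nat_power)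
  then have qd: "int q dvd int k ^ w - 1"
    by (simp add: cong_iff_dvd_diff)
  have x: "int k ^ w > 1" and xn: "int k ^ n > 1"
    using k \<open>w > 0\<close> by simp_all
  have "[k ^ n = 1] (mod p ^ a) \<longleftrightarrow> int p ^ a dvd int k ^ n - 1"
    by (metis cong_iff_dvd_diff cong_int_iff of_nat_1 of_nat_power)
  also have "\<dots> \<longleftrightarrow> a \<le> multiplicity (int p) (int k ^ n - 1)"
    using p xn by (intro power_dvd_iff_le_multiplicity) auto
  also have "multiplicity (int p) (int k ^ n - 1) =
      multiplicity (int p) ((int k ^ w) ^ r - 1)"
    by (simp add: r power_mult)
  also have "\<dots> = multiplicity (int p) (int k ^ w - 1) + multiplicity p r"
  proof (rule multiplicity_power_minus_one)
    have "int p dvd int q" using q(1) by (auto split: if_splits)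
    then show "int p dvd int k ^ w - 1" using qd by (rule dvd_trans)
  qed (use p \<open>r > 0\<close> x q(1) qd in \<open>auto\<close>)
  finally show ?thesis
    using r \<open>w > 0\<close> by (simp add: w_def)
qed

text \<open>For large \<open>a\<close> the criterion of \<open>power_cong_1_iff\<close> sees the
  base only through two numbers, both preserved by the translation. Writing the exponent with
  \<open>ord q k\<close> rather than \<open>gamma\<close> treats all primes alike.\<close>

lemma ord_translate:
  fixes k m :: nat
  assumes p: "prime p" and k: "k > 1"
    and q: "if p = 2 then q = 4 else q = p" "coprime q k"
  defines "g \<equiv> multiplicity (int p) (int k ^ ord q k - 1)"
  shows "ord (p ^ a) (k + p ^ (g + 1) * m) = ord (p ^ a) k"
proof -
  define l where "l = k + p ^ (g + 1) * m"
  have kl: "[k = l] (mod p ^ (g + 1))"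
    by (simp add: l_def cong_def)
  show ?thesis
  proof (cases "a \<le> g + 1")
    case True
    then have "[k = l] (mod p ^ a)"
      by (rule cong_dvd_modulus_nat[OF kl le_imp_power_dvd])
    then show ?thesis
      unfolding l_def[symmetric] by (intro ord_cong) (rule cong_sym)
  next
    case False
    define w where "w = ord q k"
    have "w > 0" using q(2) by (simp add: w_def ord_eq_0)
    have x: "int k ^ w > 1" using k \<open>w > 0\<close> by simp
    have mult: "int p ^ j dvd int k ^ w - 1 \<longleftrightarrow> j \<le> g" for j
      unfolding g_def w_def[symmetric]
      using p x by (intro power_dvd_iff_le_multiplicity) auto
    \<comment> \<open>Here \<open>b\<close> is the exponent of \<open>p\<close> in \<open>q\<close>;
      as \<open>b\<close> is at most \<open>g\<close>, congruence modulo \<open>p ^ (g + 1)\<close>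
      implies congruence modulo \<open>q\<close>.\<close>
    define b :: nat where "b = (if p = 2 then 2 else 1)"
    have b: "q = p ^ b" using q(1) by (auto simp: b_def)
    have "[k ^ w = 1] (mod q)" unfolding w_def by (rule ord)
    then have "int p ^ b dvd int k ^ w - 1"
      unfolding b by (metis cong_iff_dvd_diff cong_int_iff of_nat_1 of_nat_power)
    then have "b \<le> g" using mult by simp
    then have qa: "q dvd p ^ a" and "q dvd p ^ (g + 1)"
      using False by (simp_all add: b le_imp_power_dvd del: power_Suc)
    then have klq: "[k = l] (mod q)"
      using kl cong_dvd_modulus_nat by blast
    then have ordq: "ord q l = w"
      by (simp add: w_def ord_cong[OF klq])
    have cop: "coprime q l"
      using klq q(2) by (metis cong_imp_coprime coprime_commute)
    have "l > 1" using k by (simp add: l_def)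
    have "[int k ^ w = int l ^ w] (mod int p ^ (g + 1))"
      using kl by (metis cong_int_iff cong_pow of_nat_power)
    then have klw: "[int k ^ w - 1 = int l ^ w - 1] (mod int p ^ (g + 1))"
      by (intro cong_diff) auto
    then have "[int k ^ w - 1 = int l ^ w - 1] (mod int p ^ g)"
      by (rule cong_dvd_modulus) (simp add: le_imp_power_dvd)
    \<comment> \<open>Congruence modulo \<open>p ^ g\<close> alone would let the valuation rise; the
      extra factor \<open>p\<close> carries over the failure of divisibility by
      \<open>p ^ (g + 1)\<close>.\<close>
    then have "multiplicity (int p) (int l ^ w - 1) = g"
      using cong_dvd_iff[OF klw] mult[of "g + 1"] cong_dvd_iff mult[of g]
      by (intro multiplicity_eqI) auto
    then have "[k ^ n = 1] (mod p ^ a) \<longleftrightarrow> [l ^ n = 1] (mod p ^ a)" if "n > 0" for n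
      using power_cong_1_iff[OF p k that q qa] power_cong_1_iff[OF p \<open>l > 1\<close> that q(1) cop qa]
      by (simp add: ordq w_def g_def)
    \<comment> \<open>Exponent 0 is treated apart, since \<open>multiplicity p 0\<close> is the
      default value 0 rather than infinity.\<close>
    then have "[k ^ n = 1] (mod p ^ a) \<longleftrightarrow> [l ^ n = 1] (mod p ^ a)" for n
      by (cases "n = 0") auto
    then show ?thesis
      unfolding l_def[symmetric] by (intro ord_eqI) auto
  qed
qed

text \<open>The exceptional case in the definition of \<open>gamma\<close> is \<open>p = 2\<close>
  with \<open>k\<close> congruent to 3 modulo 4, which is exactly when \<open>k\<close> has order 2
  modulo 4; otherwise the orders modulo \<open>p\<close> and modulo \<open>q\<close>
  coincide.\<close>

lemma gamma_eq_multiplicity: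
  assumes p: "prime p" and k: "k > 1" "coprime p k" and q: "if p = 2 then q = 4 else q = p"
  shows "gamma p k = multiplicity (int p) (int k ^ ord q k - 1)"
proof -
  have nat_mult: "multiplicity p (k ^ u - 1) = multiplicity (int p) (int k ^ u - 1)" for u
  proof -
    have "int (k ^ u - 1) = int k ^ u - 1"
      using k by (simp add: of_nat_diff)
    then show ?thesis by (metis multiplicity_int_int)
  qed
  have op: "ord p k \<ge> 1"
    using k by (simp add: Suc_le_eq ord_eq_0)
  have "[k ^ ord p k = 1] (mod p)" by (rule ord)
  then have "p dvd k ^ ord p k - 1"
    by (intro cong_to_1_nat)
  then have ex: "\<exists>u\<ge>1. p dvd k ^ u - 1" using op by blast
  show ?thesis
  proof (cases "p = 2")
    case False
    then show ?thesis using ex q by (simp add: gamma_def flip: nat_mult)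
  next
    case True
    then have "odd k" using k by simp
    have q4: "q = 4" using True q by simp
    show ?thesis
    proof (cases "k mod 4 = 1")
      case 1: True
      have "ord p k = 1" "ord q k = 1"
        using 1 \<open>odd k\<close> True q4 by (auto simp: ord_eq_Suc_0_iff cong_def odd_iff_mod_2_eq_one)
      moreover have "\<not> (\<exists>j. odd j \<and> k - 1 = 2 * j)"
        using 1 k by presburger
      ultimately show ?thesis using ex nat_mult[of 1] by (auto simp: gamma_def)
    next
      case no1: False
      with \<open>odd k\<close> have 3: "k mod 4 = 3" by presburger
      have "[k ^ 2 = 3 ^ 2] (mod 4)"
        using 3 by (intro cong_pow) (simp add: cong_def)
      then have "ord 4 k dvd 2"
        by (simp add: ord_divides[symmetric] cong_def)
      moreover have "ord 4 k \<noteq> 1"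
        using 3 by (simp add: ord_eq_Suc_0_iff cong_def)
      ultimately have "ord q k = 2"
        using q4 by (metis prime_nat_iff two_is_prime_nat)
      moreover have "\<exists>j. odd j \<and> k - 1 = 2 * j"
        using 3 by presburger
      ultimately show ?thesis
        using ex True nat_mult[of 2] by (auto simp: gamma_def)
    qed
  qed
qed

theorem theorem3:
  fixes k p a m :: nat
  assumes "k > 0" and "prime p" and "a > 0" and "m \<noteq> 0"
  shows "ord (p ^ a) (k + gamma_power p k * m) = ord (p ^ a) k"
proof (cases "k = 1")
  case True
  then show ?thesis by (simp add: gamma_power_def)
next
  case False
  with assms have "k > 1" by simp
  show ?thesis
  proof (cases "p dvd k")
    case True
    \<comment> \<open>As \<open>k\<close> is not 1, \<open>gamma_power p k\<close> is a positive
      power of \<open>p\<close>. Both bases are thus multiples of \<open>p\<close>, and since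
      \<open>a > 0\<close> both orders are 0.\<close>
    have "p dvd k + gamma_power p k * m"
      using True False by (simp add: gamma_power_def)
    with True assms have "\<not> coprime (p ^ a) k" "\<not> coprime (p ^ a) (k + gamma_power p k * m)"
      by (auto simp: prime_imp_coprime coprime_commute coprime_absorb_left)
    then show ?thesis by (simp add: ord_eq_0)
  next
    case ndvd: False
    define q where "q = (if p = 2 then 4 else p)"
    have q: "if p = 2 then q = 4 else q = p" by (simp add: q_def)
    have cop: "coprime p k"
      using ndvd assms by (simp add: prime_imp_coprime)
    have "q dvd p ^ 2" by (simp add: q_def)
    then have "coprime q k"
      using cop coprime_divisors[of q "p ^ 2" k k] by simp
    from ord_translate[OF \<open>prime p\<close> \<open>k > 1\<close> q this]
    show ?thesis
      unfolding gamma_power_def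
      using gamma_eq_multiplicity[OF \<open>prime p\<close> \<open>k > 1\<close> cop q] False by simp
  qed
qed

end
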